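(* Let $X$ be a non-empty metrizable space. If $F_{4}(X)$ is a $k_{R}$-space, then the subspace $\mathrm{NI}(X)$ of all non-isolated points of $X$ is separable.
   Context: $F(X)$ denotes the free topological group (in the sense of Markov) over a Tychonoff space $X$, with free basis $X$. For $n\in\mathbb{N}$ (positive integers), $F_n(X)$ denotes the subspace of $F(X)$ consisting of all words of reduced length at most $n$ with respect to the free basis $X$. A topological space $Z$ is a $k_{R}$-space if $Z$ is Tychonoff and every function $f:Z\to\mathbb{R}$ whose restriction to each compact subset of $Z$ is continuous is itself continuous on $Z$. *)

theory Defs
  imports "HOL-Analysis.Analysis" "HOL-Algebra.Group"
begin

text \<open>A letter is a generator with a sign: \<open>(x, True)\<close> stands for \<open>x\<close> and \<open>(x, False)\<close> for
  the formal inverse of \<open>x\<close>. Elements of the free group are the reduced words, so the reduced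
  length of an element is its \<open>length\<close>.\<close>

type_synonym 'a letter = "'a \<times> bool"

definition opp :: "'a letter \<Rightarrow> 'a letter"
  where "opp s = (fst s, \<not> snd s)"

fun reduced_word :: "'a letter list \<Rightarrow> bool"
  where
    "reduced_word [] \<longleftrightarrow> True"
  | "reduced_word [s] \<longleftrightarrow> True"
  | "reduced_word (s # t # w) \<longleftrightarrow> t \<noteq> opp s \<and> reduced_word (t # w)"

text \<open>Reduced form of \<open>s # w\<close>, for a reduced word \<open>w\<close>.\<close>

fun push :: "'a letter \<Rightarrow> 'a letter list \<Rightarrow> 'a letter list"
  where
    "push s [] = [s]"
  | "push s (t # w) = (if t = opp s then w else s # t # w)"

definition free_group :: "'a set \<Rightarrow> 'a letter list monoid"
  where "free_group A =
    \<lparr>carrier = {w. reduced_word w \<and> fst ` set w \<subseteq> A},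
     monoid.mult = (\<lambda>u v. foldr push u v),
     one = []\<rparr>"

definition free_basis :: "'a \<Rightarrow> 'a letter list"
  where "free_basis x = [(x, True)]"

text \<open>No separation axiom is required of a topological group. For Tychonoff \<open>X\<close> this makes no
  difference to \<open>F(X)\<close>: the finest group topology below is finer than a Hausdorff one, hence
  Hausdorff.\<close>

definition topological_group :: "('g, 'm) monoid_scheme \<Rightarrow> 'g topology \<Rightarrow> bool"
  where "topological_group G T \<longleftrightarrow>
    group G \<and> topspace T = carrier G \<and>
    continuous_map (prod_topology T T) T (\<lambda>(x, y). x \<otimes>\<^bsub>G\<^esub> y) \<and>
    continuous_map T T (\<lambda>x. inv\<^bsub>G\<^esub> x)"

text \<open>The topology of \<open>F(X)\<close> is the finest group topology on the free group over the points of
  \<open>X\<close> for which the inclusion of the basis is continuous, defined as the supremum of all such group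
  topologies. The supremum is itself a group topology (\<open>topological_group_free\<close>), it has the
  universal property of the free topological group with respect to topological groups of
  arbitrary type (\<open>free_topology_universal\<close>), and \<open>X\<close> is a subspace of \<open>F(X)\<close> if it is
  Tychonoff (\<open>embedding_map_free_basis\<close>).\<close>

definition free_topology :: "'a topology \<Rightarrow> 'a letter list topology"
  where "free_topology X = topology_generated_by
    {U. \<exists>T. topological_group (free_group (topspace X)) T \<and>
            continuous_map X T free_basis \<and> openin T U}"

text \<open>The subspace \<open>F\<^sub>n(X)\<close> of \<open>F(X)\<close>.\<close>

definition words_le :: "nat \<Rightarrow> 'a topology \<Rightarrow> 'a letter list topology"
  where "words_le n X = subtopology (free_topology X)
    {w \<in> carrier (free_group (topspace X)). length w \<le> n}"

definition tychonoff_space :: "'a topology \<Rightarrow> bool"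
  where "tychonoff_space Z \<longleftrightarrow> completely_regular_space Z \<and> Hausdorff_space Z"

definition k\<^sub>R_space :: "'a topology \<Rightarrow> bool"
  where "k\<^sub>R_space Z \<longleftrightarrow> tychonoff_space Z \<and>
    (\<forall>f :: 'a \<Rightarrow> real.
       (\<forall>K. compactin Z K \<longrightarrow> continuous_map (subtopology Z K) euclideanreal f) \<longrightarrow>
       continuous_map Z euclideanreal f)"

definition non_isolated :: "'a topology \<Rightarrow> 'a set"
  where "non_isolated X = {x \<in> topspace X. \<not> openin X {x}}"

lemma opp_opp [simp]: "opp (opp s) = s"
  by (simp add: opp_def)

lemma opp_neq [simp]: "opp s \<noteq> s" "s \<noteq> opp s"
  by (auto simp: opp_def prod_eq_iff)

lemma fst_opp [simp]: "fst (opp s) = fst s"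
  by (simp add: opp_def)

lemma reduced_Cons: "reduced_word (s # w) \<Longrightarrow> reduced_word w"
  by (cases w) auto

lemma reduced_push: "reduced_word w \<Longrightarrow> reduced_word (push s w)"
  by (cases w) (auto dest: reduced_Cons)

lemma push_reduced: "reduced_word (s # w) \<Longrightarrow> push s w = s # w"
  by (cases w) auto

lemma push_push: "reduced_word w \<Longrightarrow> push s (push (opp s) w) = w"
  by (cases w) (auto simp: push_reduced)

lemma push_push': "reduced_word w \<Longrightarrow> push (opp s) (push s w) = w"
  using push_push[of w "opp s"] by simp

lemma set_push: "set (push s w) \<subseteq> insert s (set w)"
  by (cases w) auto

lemma reduced_foldr: "reduced_word v \<Longrightarrow> reduced_word (foldr push u v)"
  by (induction u) (auto simp: reduced_push)

lemma set_foldr: "set (foldr push u v) \<subseteq> set u \<union> set v"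
proof (induction u)
  case (Cons s u)
  then show ?case using set_push[of s "foldr push u v"] by auto
qed auto

lemma foldr_push_Nil: "reduced_word w \<Longrightarrow> foldr push w [] = w"
proof (induction w)
  case (Cons s w)
  then show ?case using reduced_Cons[of s w] push_reduced[of s w] by simp
qed auto

lemma foldr_push_assoc1:
  assumes "reduced_word w"
  shows "foldr push (push s z) w = push s (foldr push z w)"
proof (cases z)
  case (Cons t z')
  then show ?thesis using push_push[of "foldr push z' w" s] reduced_foldr[OF assms] by auto
qed auto

lemma foldr_push_assoc:
  "reduced_word w \<Longrightarrow> foldr push (foldr push u v) w = foldr push u (foldr push v w)"
  by (induction u) (auto simp: foldr_push_assoc1)

lemma foldr_push_inverse:
  "reduced_word v \<Longrightarrow> foldr push (rev (map opp u)) (foldr push u v) = v"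
  by (induction u arbitrary: v) (auto simp: push_push' reduced_foldr)

lemma carrier_free_group: "carrier (free_group A) = {w. reduced_word w \<and> fst ` set w \<subseteq> A}"
  and mult_free_group: "u \<otimes>\<^bsub>free_group A\<^esub> v = foldr push u v"
  and one_free_group: "\<one>\<^bsub>free_group A\<^esub> = []"
  by (simp_all add: free_group_def)

lemma mult_free_group_closed:
  assumes "fst ` set u \<subseteq> A" "v \<in> carrier (free_group A)"
  shows "foldr push u v \<in> carrier (free_group A)"
  using assms set_foldr[of u v] reduced_foldr[of v u] by (fastforce simp: carrier_free_group)

lemma group_free_group: "group (free_group A)"
proof (rule groupI)
  fix u assume u: "u \<in> carrier (free_group A)"
  let ?r = "rev (map opp u)"
  have r: "fst ` set ?r \<subseteq> A" using u by (auto simp: carrier_free_group)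
  have rc: "foldr push ?r [] \<in> carrier (free_group A)"
    using mult_free_group_closed[OF r] by (simp add: carrier_free_group)
  have "foldr push (foldr push ?r []) u = foldr push ?r (foldr push u [])"
    using u by (simp add: carrier_free_group foldr_push_assoc foldr_push_Nil del: rev_map foldr_append)
  then show "\<exists>v\<in>carrier (free_group A). v \<otimes>\<^bsub>free_group A\<^esub> u = \<one>\<^bsub>free_group A\<^esub>"
    using rc foldr_push_inverse[of "[]" u] by (auto simp: mult_free_group one_free_group)
qed (auto simp: mult_free_group one_free_group foldr_push_assoc carrier_free_group
       intro: reduced_foldr dest!: subsetD[OF set_foldr])

lemma free_basis_closed: "x \<in> A \<Longrightarrow> free_basis x \<in> carrier (free_group A)"
  by (auto simp: carrier_free_group free_basis_def)

definition eval_letter :: "('g, 'm) monoid_scheme \<Rightarrow> ('a \<Rightarrow> 'g) \<Rightarrow> 'a letter \<Rightarrow> 'g"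
  where "eval_letter G f s = (if snd s then f (fst s) else inv\<^bsub>G\<^esub> (f (fst s)))"

definition eval_word :: "('g, 'm) monoid_scheme \<Rightarrow> ('a \<Rightarrow> 'g) \<Rightarrow> 'a letter list \<Rightarrow> 'g"
  where "eval_word G f w = foldr (\<lambda>s g. eval_letter G f s \<otimes>\<^bsub>G\<^esub> g) w \<one>\<^bsub>G\<^esub>"

context group
begin

lemma eval_word_closed:
  assumes "f ` A \<subseteq> carrier G" "fst ` set w \<subseteq> A"
  shows "eval_word G f w \<in> carrier G"
  using assms(2)
proof (induction w)
  case (Cons s w)
  then have "f (fst s) \<in> carrier G" using assms(1) by auto
  with Cons show ?case by (auto simp: eval_word_def eval_letter_def)
qed (simp add: eval_word_def)

lemma eval_word_push:
  assumes f: "f ` A \<subseteq> carrier G" and "fst s \<in> A" "fst ` set w \<subseteq> A"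
  shows "eval_word G f (push s w) = eval_letter G f s \<otimes> eval_word G f w"
proof (cases w)
  case Nil
  then show ?thesis by (simp add: eval_word_def)
next
  case (Cons t v)
  have fs: "f (fst s) \<in> carrier G" using assms by auto
  have v: "eval_word G f v \<in> carrier G" using eval_word_closed[OF f] assms(3) Cons by auto
  have w: "eval_word G f w = eval_letter G f t \<otimes> eval_word G f v"
    using Cons by (simp add: eval_word_def)
  show ?thesis
  proof (cases "t = opp s")
    case True
    have "eval_letter G f s \<otimes> eval_letter G f t = \<one>"
      using fs True by (auto simp: eval_letter_def opp_def)
    moreover have "eval_letter G f s \<in> carrier G" "eval_letter G f t \<in> carrier G"
      using fs True by (auto simp: eval_letter_def)
    ultimately show ?thesis using v w True Cons by (simp flip: m_assoc)
  next
    case False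
    then show ?thesis using Cons by (simp add: eval_word_def)
  qed
qed

lemma eval_word_foldr:
  assumes f: "f ` A \<subseteq> carrier G" and "fst ` set u \<subseteq> A" and v: "fst ` set v \<subseteq> A"
  shows "eval_word G f (foldr push u v) = eval_word G f u \<otimes> eval_word G f v"
  using assms(2)
proof (induction u)
  case Nil
  then show ?case using eval_word_closed[OF f v] by (simp add: eval_word_def)
next
  case (Cons s u)
  have 1: "fst ` set (foldr push u v) \<subseteq> A" using Cons.prems v set_foldr[of u v] by fastforce
  have 2: "f (fst s) \<in> carrier G" using Cons.prems f by auto
  then have 3: "eval_letter G f s \<in> carrier G" by (auto simp: eval_letter_def)
  have 4: "eval_word G f u \<in> carrier G" "eval_word G f v \<in> carrier G"
    using eval_word_closed[OF f] Cons.prems v by auto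
  have "eval_word G f (foldr push (s # u) v) = eval_letter G f s \<otimes> (eval_word G f u \<otimes> eval_word G f v)"
    using Cons eval_word_push[OF f _ 1, of s] by simp
  also have "\<dots> = eval_word G f (s # u) \<otimes> eval_word G f v"
    using 3 4 by (simp add: eval_word_def m_assoc)
  finally show ?case .
qed

lemma eval_word_hom:
  assumes "f ` A \<subseteq> carrier G"
  shows "eval_word G f \<in> hom (free_group A) G"
  using eval_word_closed[OF assms] eval_word_foldr[OF assms]
  by (auto simp: hom_def carrier_free_group mult_free_group)

lemma eval_word_basis:
  "f x \<in> carrier G \<Longrightarrow> eval_word G f (free_basis x) = f x"
  by (simp add: eval_word_def eval_letter_def free_basis_def)

lemma free_group_hom_unique:
  assumes h: "h \<in> hom (free_group A) G" and k: "k \<in> hom (free_group A) G"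
    and eq: "\<And>x. x \<in> A \<Longrightarrow> h (free_basis x) = k (free_basis x)"
    and w: "w \<in> carrier (free_group A)"
  shows "h w = k w"
proof -
  interpret F: group "free_group A" by (rule group_free_group)
  have letter: "h [s] = k [s]" if "fst s \<in> A" for s
  proof (cases "snd s")
    case True
    then have "[s] = free_basis (fst s)" by (simp add: free_basis_def prod_eq_iff)
    then show ?thesis using eq that by simp
  next
    case False
    have b: "free_basis (fst s) \<in> carrier (free_group A)" using that by (rule free_basis_closed)
    have s: "[s] \<in> carrier (free_group A)" using that by (simp add: carrier_free_group)
    have "[s] \<otimes>\<^bsub>free_group A\<^esub> free_basis (fst s) = \<one>\<^bsub>free_group A\<^esub>"
      using False by (simp add: mult_free_group one_free_group free_basis_def opp_def)
    then have "[s] = inv\<^bsub>free_group A\<^esub> free_basis (fst s)"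
      using F.inv_equality[OF _ b s] by simp
    moreover have "h (inv\<^bsub>free_group A\<^esub> free_basis (fst s)) = inv (h (free_basis (fst s)))"
      using group_hom.hom_inv[of "free_group A" G h] b h
      by (simp add: group_hom_def group_hom_axioms_def F.is_group)
    moreover have "k (inv\<^bsub>free_group A\<^esub> free_basis (fst s)) = inv (k (free_basis (fst s)))"
      using group_hom.hom_inv[of "free_group A" G k] b k
      by (simp add: group_hom_def group_hom_axioms_def F.is_group)
    ultimately show ?thesis using eq that by simp
  qed
  show ?thesis using w
  proof (induction w)
    case Nil
    then show ?case using h k hom_one[of h "free_group A" G] hom_one[of k "free_group A" G]
      by (simp add: one_free_group F.is_group)
  next
    case (Cons s w)
    have s: "[s] \<in> carrier (free_group A)" and w: "w \<in> carrier (free_group A)"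
      using Cons.prems by (auto simp: carrier_free_group dest: reduced_Cons)
    have "s # w = [s] \<otimes>\<^bsub>free_group A\<^esub> w"
      using Cons.prems by (simp add: carrier_free_group mult_free_group push_reduced)
    then show ?case using hom_mult[OF h s w] hom_mult[OF k s w] letter[of s] Cons.IH[OF w] s
      by (simp add: carrier_free_group)
  qed
qed

end

text \<open>The indiscrete topology is one of the group topologies in the definition.\<close>

lemma topological_group_indiscrete:
  assumes "group G"
  shows "topological_group G (pullback_topology (carrier G) (\<lambda>_. ()) (discrete_topology {()}))"
proof -
  interpret group G by fact
  show ?thesis
    unfolding topological_group_def
    by (auto simp: assms topspace_pullback_topology intro!: continuous_map_pullback')
qed

lemma topspace_free_topology [simp]:
  "topspace (free_topology X) = carrier (free_group (topspace X))"
proof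
  show "topspace (free_topology X) \<subseteq> carrier (free_group (topspace X))"
    unfolding free_topology_def topology_generated_by_topspace topological_group_def
    by (auto dest: openin_subset)
  let ?T = "pullback_topology (carrier (free_group (topspace X))) (\<lambda>_. ()) (discrete_topology {()})"
  have tg: "topological_group (free_group (topspace X)) ?T"
    by (rule topological_group_indiscrete[OF group_free_group])
  have "continuous_map X ?T free_basis"
    by (rule continuous_map_pullback') (auto simp: free_basis_closed)
  moreover have "openin ?T (carrier (free_group (topspace X)))"
    using openin_topspace[of ?T] by (simp add: topspace_pullback_topology)
  ultimately show "carrier (free_group (topspace X)) \<subseteq> topspace (free_topology X)"
    unfolding free_topology_def topology_generated_by_topspace using tg by blast
qed

lemma openin_free_topology:
  assumes "topological_group (free_group (topspace X)) T" "continuous_map X T free_basis" "openin T U"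
  shows "openin (free_topology X) U"
  unfolding free_topology_def by (rule topology_generated_by_Basis) (use assms in blast)

lemma continuous_map_into_free_topology:
  assumes f: "f ` topspace Y \<subseteq> carrier (free_group (topspace X))"
    and T: "\<And>T. topological_group (free_group (topspace X)) T \<Longrightarrow> continuous_map X T free_basis
           \<Longrightarrow> continuous_map Y T f"
  shows "continuous_map Y (free_topology X) f"
  unfolding free_topology_def
proof (rule continuous_on_generated_topo)
  let ?S = "{U. \<exists>T. topological_group (free_group (topspace X)) T \<and>
            continuous_map X T free_basis \<and> openin T U}"
  show "f ` topspace Y \<subseteq> \<Union> ?S"
    using f topspace_free_topology[of X]
    unfolding free_topology_def topology_generated_by_topspace by simp
  fix U assume "U \<in> ?S"
  then obtain T where "topological_group (free_group (topspace X)) T"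
    "continuous_map X T free_basis" "openin T U" by blast
  then have "openin Y {x \<in> topspace Y. f x \<in> U}"
    using T openin_continuous_map_preimage by blast
  then show "openin Y (f -` U \<inter> topspace Y)"
    by (simp add: vimage_def Int_def conj_commute)
qed

lemma continuous_map_id_free_topology:
  assumes T: "topological_group (free_group (topspace X)) T" "continuous_map X T free_basis"
  shows "continuous_map (free_topology X) T id"
proof -
  have sp: "topspace T = carrier (free_group (topspace X))"
    using T by (simp add: topological_group_def)
  have "openin (free_topology X) {x \<in> carrier (free_group (topspace X)). x \<in> U}" if "openin T U" for U
  proof -
    have "{x \<in> carrier (free_group (topspace X)). x \<in> U} = U"
      using openin_subset[OF that] sp by auto
    then show ?thesis using openin_free_topology[OF T that] by simp
  qed
  then show ?thesis by (auto simp: continuous_map_def sp)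
qed

lemma continuous_map_free_basis: "continuous_map X (free_topology X) free_basis"
  by (rule continuous_map_into_free_topology) (auto simp: free_basis_closed)

lemma topological_group_free:
  "topological_group (free_group (topspace X)) (free_topology X)"
proof -
  let ?F = "free_group (topspace X)"
  interpret F: group ?F by (rule group_free_group)
  have "continuous_map (prod_topology (free_topology X) (free_topology X)) (free_topology X)
          (\<lambda>(x, y). x \<otimes>\<^bsub>?F\<^esub> y)"
  proof (rule continuous_map_into_free_topology)
    fix T assume T: "topological_group ?F T" "continuous_map X T free_basis"
    have "continuous_map (prod_topology (free_topology X) (free_topology X)) (prod_topology T T)
            (\<lambda>(x, y). (id x, id y))"
      using continuous_map_id_free_topology[OF T] unfolding continuous_map_prod_top by blast
    moreover have "continuous_map (prod_topology T T) T (\<lambda>(x, y). x \<otimes>\<^bsub>?F\<^esub> y)"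
      using T by (simp add: topological_group_def)
    ultimately have "continuous_map (prod_topology (free_topology X) (free_topology X)) T
            ((\<lambda>(x, y). x \<otimes>\<^bsub>?F\<^esub> y) \<circ> (\<lambda>(x, y). (id x, id y)))"
      by (rule continuous_map_compose)
    then show "continuous_map (prod_topology (free_topology X) (free_topology X)) T
            (\<lambda>(x, y). x \<otimes>\<^bsub>?F\<^esub> y)"
      by (simp add: o_def case_prod_unfold)
  qed auto
  moreover have "continuous_map (free_topology X) (free_topology X) (\<lambda>x. inv\<^bsub>?F\<^esub> x)"
  proof (rule continuous_map_into_free_topology)
    fix T assume T: "topological_group ?F T" "continuous_map X T free_basis"
    have "continuous_map T T (\<lambda>x. inv\<^bsub>?F\<^esub> x)"
      using T by (simp add: topological_group_def)
    from continuous_map_compose[OF continuous_map_id_free_topology[OF T] this]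
    show "continuous_map (free_topology X) T (\<lambda>x. inv\<^bsub>?F\<^esub> x)"
      by (simp add: o_def)
  qed auto
  ultimately show ?thesis by (simp add: topological_group_def F.is_group)
qed

lemma topological_group_pullback:
  assumes T: "topological_group G T" and F: "group F" and h: "h \<in> hom F G"
  shows "topological_group F (pullback_topology (carrier F) h T)"
proof -
  interpret F: group F by fact
  interpret G: group G using T by (simp add: topological_group_def)
  interpret group_hom F G h using h by unfold_locales
  have sp: "topspace T = carrier G" using T by (simp add: topological_group_def)
  let ?P = "pullback_topology (carrier F) h T"
  have spP: "topspace ?P = carrier F"
    by (auto simp: topspace_pullback_topology sp)
  have ch: "continuous_map ?P T h"
    using continuous_map_pullback[OF continuous_map_id, of "carrier F" h T] by simp
  have "continuous_map (prod_topology ?P ?P) ?P (\<lambda>(x, y). x \<otimes>\<^bsub>F\<^esub> y)"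
  proof (rule continuous_map_pullback')
    have "continuous_map (prod_topology ?P ?P) (prod_topology T T) (\<lambda>(x, y). (h x, h y))"
      using ch by (simp add: continuous_map_prod_top)
    moreover have "continuous_map (prod_topology T T) T (\<lambda>(x, y). x \<otimes>\<^bsub>G\<^esub> y)"
      using T by (simp add: topological_group_def)
    ultimately have "continuous_map (prod_topology ?P ?P) T
        ((\<lambda>(x, y). x \<otimes>\<^bsub>G\<^esub> y) \<circ> (\<lambda>(x, y). (h x, h y)))"
      by (rule continuous_map_compose)
    then show "continuous_map (prod_topology ?P ?P) T (h \<circ> (\<lambda>(x, y). x \<otimes>\<^bsub>F\<^esub> y))"
      by (rule continuous_map_eq) (auto simp: spP)
  qed (auto simp: spP)
  moreover have "continuous_map ?P ?P (\<lambda>x. inv\<^bsub>F\<^esub> x)"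
  proof (rule continuous_map_pullback')
    have "continuous_map T T (\<lambda>x. inv\<^bsub>G\<^esub> x)"
      using T by (simp add: topological_group_def)
    from continuous_map_compose[OF ch this]
    show "continuous_map ?P T (h \<circ> (\<lambda>x. inv\<^bsub>F\<^esub> x))"
      by (rule continuous_map_eq) (auto simp: spP)
  qed (auto simp: spP)
  ultimately show ?thesis using F spP by (simp add: topological_group_def)
qed

lemma continuous_map_eval_word:
  assumes T: "topological_group G T" and f: "continuous_map X T f"
  shows "continuous_map (free_topology X) T (eval_word G f)"
proof -
  interpret G: group G using T by (simp add: topological_group_def)
  have sp: "topspace T = carrier G" using T by (simp add: topological_group_def)
  have f': "f ` topspace X \<subseteq> carrier G"
    using continuous_map_image_subset_topspace[OF f] sp by simp
  let ?F = "free_group (topspace X)"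
  let ?h = "eval_word G f"
  have h: "?h \<in> hom ?F G" by (rule G.eval_word_hom[OF f'])
  let ?P = "pullback_topology (carrier ?F) ?h T"
  have P: "topological_group ?F ?P"
    by (rule topological_group_pullback[OF T group_free_group h])
  have cP: "continuous_map X ?P free_basis"
  proof (rule continuous_map_pullback')
    show "continuous_map X T (?h \<circ> free_basis)"
      using f by (rule continuous_map_eq) (use f' in \<open>auto simp: G.eval_word_basis\<close>)
  qed (auto simp: free_basis_closed)
  have "continuous_map ?P T ?h"
    using continuous_map_pullback[OF continuous_map_id, of "carrier ?F" ?h T] by simp
  from continuous_map_compose[OF continuous_map_id_free_topology[OF P cP] this]
  show ?thesis by simp
qed

theorem free_topology_universal:
  assumes T: "topological_group G T" and f: "continuous_map X T f"
  shows "\<exists>h. h \<in> hom (free_group (topspace X)) G \<and> continuous_map (free_topology X) T h \<and>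
             (\<forall>x \<in> topspace X. h (free_basis x) = f x)"
    and "\<lbrakk>h \<in> hom (free_group (topspace X)) G; k \<in> hom (free_group (topspace X)) G;
          \<forall>x \<in> topspace X. h (free_basis x) = f x; \<forall>x \<in> topspace X. k (free_basis x) = f x\<rbrakk>
         \<Longrightarrow> \<forall>w \<in> carrier (free_group (topspace X)). h w = k w"
proof -
  interpret G: group G using T by (simp add: topological_group_def)
  have f': "f ` topspace X \<subseteq> carrier G"
    using continuous_map_image_subset_topspace[OF f] T by (simp add: topological_group_def)
  show "\<exists>h. h \<in> hom (free_group (topspace X)) G \<and> continuous_map (free_topology X) T h \<and>
             (\<forall>x \<in> topspace X. h (free_basis x) = f x)"
    using G.eval_word_hom[OF f'] continuous_map_eval_word[OF T f] G.eval_word_basis[of f] f'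
    by blast
  show "\<forall>w \<in> carrier (free_group (topspace X)). h w = k w"
    if "h \<in> hom (free_group (topspace X)) G" "k \<in> hom (free_group (topspace X)) G"
       "\<forall>x \<in> topspace X. h (free_basis x) = f x" "\<forall>x \<in> topspace X. k (free_basis x) = f x"
    using G.free_group_hom_unique[OF that(1,2)] that(3,4) by auto
qed

definition real_group :: "real monoid"
  where "real_group = \<lparr>carrier = UNIV, monoid.mult = (+), one = 0\<rparr>"

lemma topological_group_real: "topological_group real_group euclideanreal"
proof -
  interpret group real_group
  proof (rule groupI)
    show "\<exists>y\<in>carrier real_group. y \<otimes>\<^bsub>real_group\<^esub> x = \<one>\<^bsub>real_group\<^esub>" for x
      by (rule bexI[of _ "- x"]) (simp_all add: real_group_def)
  qed (auto simp: real_group_def)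
  have "inv\<^bsub>real_group\<^esub> x = - x" for x
    by (rule inv_equality) (auto simp: real_group_def)
  moreover have "group real_group" by (rule is_group)
  ultimately show ?thesis
    unfolding topological_group_def
    by (simp add: real_group_def case_prod_unfold continuous_on_add continuous_on_fst
        continuous_on_snd continuous_on_minus)
qed

theorem embedding_map_free_basis:
  assumes "tychonoff_space X"
  shows "embedding_map X (free_topology X) free_basis"
proof -
  let ?T = "free_topology X"
  have inj: "inj_on free_basis (topspace X)" by (simp add: inj_on_def free_basis_def)
  have op: "\<exists>V. openin ?T V \<and> free_basis ` U = V \<inter> free_basis ` topspace X" if U: "openin X U" for U
  proof -
    have "\<exists>V. openin ?T V \<and> free_basis x \<in> V \<and> V \<inter> free_basis ` topspace X \<subseteq> free_basis ` U"
      if x: "x \<in> U" for x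
    proof -
      have "x \<in> topspace X" using U x openin_subset by blast
      then obtain f :: "_ \<Rightarrow> real" where f: "continuous_map X (top_of_set {0..1}) f" "f x = 0"
        "f ` (topspace X - U) \<subseteq> {1}"
        using assms U x unfolding tychonoff_space_def completely_regular_space_def
        by (metis DiffD2 DiffI closedin_def Diff_Diff_Int Diff_subset inf.absorb_iff2 openin_subset)
      have f': "continuous_map X euclideanreal f"
        using f(1) by (simp add: continuous_map_in_subtopology)
      obtain h where h: "continuous_map ?T euclideanreal h" "\<forall>y \<in> topspace X. h (free_basis y) = f y"
        using free_topology_universal(1)[OF topological_group_real f'] by blast
      let ?V = "{w \<in> topspace ?T. h w \<in> {..<1}}"
      have "openin ?T ?V"
        by (rule openin_continuous_map_preimage[OF h(1)]) auto
      moreover have "free_basis x \<in> ?V"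
        using h(2) f(2) \<open>x \<in> topspace X\<close> by (simp add: free_basis_closed)
      moreover have "?V \<inter> free_basis ` topspace X \<subseteq> free_basis ` U"
        using h(2) f(3) by fastforce
      ultimately show ?thesis by blast
    qed
    then obtain V where V: "\<And>x. x \<in> U \<Longrightarrow> openin ?T (V x) \<and> free_basis x \<in> V x \<and>
        V x \<inter> free_basis ` topspace X \<subseteq> free_basis ` U" by metis
    have "openin ?T (\<Union>x\<in>U. V x)" using V by blast
    moreover have "free_basis ` U = (\<Union>x\<in>U. V x) \<inter> free_basis ` topspace X"
      using V openin_subset[OF U] by blast
    ultimately show ?thesis by blast
  qed
  show ?thesis
    unfolding embedding_map_def homeomorphic_map_def
  proof (intro bijective_open_imp_homeomorphic_map[unfolded homeomorphic_map_def])
    show "continuous_map X (subtopology ?T (free_basis ` topspace X)) free_basis"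
      by (simp add: continuous_map_in_subtopology continuous_map_free_basis)
    show "open_map X (subtopology ?T (free_basis ` topspace X)) free_basis"
      unfolding open_map_def openin_subtopology using op by blast
    show "free_basis ` topspace X = topspace (subtopology ?T (free_basis ` topspace X))"
      by (auto simp: free_basis_closed)
  qed (rule inj)
qed

end

theory Submission
  imports Defs
begin

text \<open>If the set of non-isolated points is not separable, it has an uncountable subset \<open>A\<close> whose points
  are at distance at least \<open>e > 0\<close> from each other, and \<open>A\<close> may be taken to inject into the reals by
  some \<open>r\<close>. Choose points \<open>y a n \<noteq> a\<close> tending to \<open>a\<close>, and let \<open>h a b\<close> be about \<open>1 / \<bar>r a - r b\<bar>\<close>, so that \<open>h\<close>
  is unbounded on the pairs from any uncountable subset of \<open>A\<close>. It follows that the words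
  \<open>a\<^sup>-\<^sup>1 (y a n) b\<^sup>-\<^sup>1 (y b n)\<close> with \<open>n = h a b\<close> accumulate at the identity. For each pair \<open>(a, b)\<close> there
  is a continuous function that is 1 at the corresponding word and vanishes at the identity, and
  only finitely many of these functions are nonzero on a given compact set. Their sum is therefore
  continuous on every compact set, but not at the identity.\<close>

section \<open>Locally finite sums of continuous functions\<close>

text \<open>A set \<open>V\<close> that only finitely many \<open>f i\<close> fail to vanish on
  turns the sum into one over a fixed finite index set; these local sums are pasted. The sum runs
  over the nonzero terms only, since \<open>sum\<close> over an infinite set defaults to 0.\<close>

lemma continuous_map_locally_finite_sum:
  fixes f :: "'i \<Rightarrow> 'a \<Rightarrow> 'b::real_normed_vector"
  assumes cont: "\<And>i. i \<in> I \<Longrightarrow> continuous_map X euclidean (f i)"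
    and loc: "\<And>x. x \<in> topspace X \<Longrightarrow>
               \<exists>V. openin X V \<and> x \<in> V \<and> finite {i \<in> I. \<exists>z\<in>V. f i z \<noteq> 0}"
  shows "continuous_map X euclidean (\<lambda>x. \<Sum>i\<in>{i \<in> I. f i x \<noteq> 0}. f i x)"
proof -
  let ?J = "\<lambda>V. {i \<in> I. \<exists>z\<in>V. f i z \<noteq> 0}"
  let ?g = "\<lambda>x. \<Sum>i\<in>{i \<in> I. f i x \<noteq> 0}. f i x"
  have eq: "?g x = (\<Sum>i\<in>?J V. f i x)" if "finite (?J V)" "x \<in> V" for V x
    by (rule sum.mono_neutral_left) (use that in auto)
  show ?thesis
  proof (rule pasting_lemma[where I = "{V. openin X V \<and> finite (?J V)}" and T = "\<lambda>V. V"
        and f = "\<lambda>V x. \<Sum>i\<in>?J V. f i x"])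
    fix V assume "V \<in> {V. openin X V \<and> finite (?J V)}"
    then show "continuous_map (subtopology X V) euclidean (\<lambda>x. \<Sum>i\<in>?J V. f i x)"
      by (intro continuous_map_from_subtopology continuous_map_sum) (auto intro: cont)
  next
    fix U V x
    assume "U \<in> {V. openin X V \<and> finite (?J V)}" "V \<in> {V. openin X V \<and> finite (?J V)}"
      "x \<in> topspace X \<inter> U \<inter> V"
    then show "(\<Sum>i\<in>?J U. f i x) = (\<Sum>i\<in>?J V. f i x)"
      using eq[of U x] eq[of V x] by simp
  next
    fix x assume "x \<in> topspace X"
    then obtain V where "openin X V" "x \<in> V" "finite (?J V)"
      using loc by blast
    then show "\<exists>V. V \<in> {V. openin X V \<and> finite (?J V)} \<and> x \<in> V \<and> ?g x = (\<Sum>i\<in>?J V. f i x)"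
      using eq[of V x] by blast
  qed auto
qed

section \<open>Homomorphisms from the free group into normed spaces\<close>

text \<open>Generalizes \<open>real_group\<close>, because the compactness argument below maps the
  free group into a Banach space of sequences.\<close>

definition additive_group :: "'b::real_normed_vector monoid"
  where "additive_group = \<lparr>carrier = UNIV, monoid.mult = (+), one = 0\<rparr>"

lemma additive_group_simps [simp]:
  "carrier additive_group = UNIV" "x \<otimes>\<^bsub>additive_group\<^esub> y = x + y" "\<one>\<^bsub>additive_group\<^esub> = 0"
  by (simp_all add: additive_group_def)

lemma group_additive_group: "group (additive_group :: 'b::real_normed_vector monoid)"
proof (rule groupI)
  show "\<exists>y\<in>carrier additive_group. y \<otimes>\<^bsub>additive_group\<^esub> x = \<one>\<^bsub>additive_group\<^esub>" for x :: 'b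
    by (rule bexI[of _ "- x"]) simp_all
qed auto

lemma inv_additive_group [simp]: "inv\<^bsub>additive_group\<^esub> x = - x"
  by (rule group.inv_equality[OF group_additive_group]) simp_all

lemma topological_group_additive_group:
  "topological_group (additive_group :: 'b::real_normed_vector monoid) euclidean"
proof -
  have "continuous_on UNIV (\<lambda>p. fst p + snd p :: 'b)"
    by (intro continuous_intros)
  then show ?thesis
    unfolding topological_group_def
    by (simp add: group_additive_group continuous_on_minus case_prod_unfold)
qed

lemma real_group_eq_additive_group: "real_group = additive_group"
  by (simp add: real_group_def additive_group_def)

text \<open>Used for scalings of the reals and for the coordinate functionals on bounded
  sequences.\<close>

lemma eval_word_additive_group:
  assumes "\<And>u v. h (u + v) = h u + h v"
  shows "h (eval_word additive_group f w) = eval_word additive_group (\<lambda>x. h (f x)) w"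
proof -
  interpret additive h by (rule additive.intro) (rule assms)
  show ?thesis
    by (induction w) (auto simp: eval_word_def eval_letter_def add zero minus)
qed

lemma eval_word_real_scale:
  "eval_word real_group (\<lambda>x. c * f x) w = c * eval_word real_group f w"
  using eval_word_additive_group[of "\<lambda>u. c * u" f w]
  by (simp add: real_group_eq_additive_group distrib_left)

lemma eval_word_real_foldr:
  "eval_word real_group f (foldr push u v) = eval_word real_group f u + eval_word real_group f v"
  using group.eval_word_foldr[OF group_additive_group, of f UNIV u v]
  by (simp add: real_group_eq_additive_group)

lemma continuous_map_eval_word_real:
  "continuous_map X euclideanreal f \<Longrightarrow>
   continuous_map (free_topology X) euclideanreal (eval_word real_group f)"
  by (rule continuous_map_eval_word[OF topological_group_real])

section \<open>Locally finite families on compact sets of words\<close>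

text \<open>As \<open>nat\<close> is discrete, \<open>nat \<Rightarrow>\<^sub>C real\<close> is the
  space of bounded sequences with the sup norm, and these are its unit vectors.\<close>

definition unit_bcontfun :: "nat \<Rightarrow> nat \<Rightarrow>\<^sub>C real"
  where "unit_bcontfun k = Bcontfun (\<lambda>j. if j = k then 1 else 0)"

lemma apply_unit_bcontfun: "apply_bcontfun (unit_bcontfun k) j = (if j = k then 1 else 0)"
proof -
  have "(\<lambda>j. if j = k then 1 else 0 :: real) \<in> bcontfun"
    by (rule bcontfun_normI[where b = 1]) (auto simp: continuous_on_discrete)
  then show ?thesis
    by (simp add: unit_bcontfun_def Bcontfun_inverse)
qed

lemma apply_bcontfun_sum:
  "apply_bcontfun (sum f S) j = (\<Sum>i\<in>S. apply_bcontfun (f i) j)"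
  for f :: "'i \<Rightarrow> 'a::topological_space \<Rightarrow>\<^sub>C 'b::real_normed_vector"
  by (induction S rule: infinite_finite_induct) auto

text \<open>If \<open>w\<^sub>k \<in> K\<close> witnesses the nonvanishing of the \<open>k\<close>-th function, rescale the functions so that
  the \<open>k\<close>-th one takes the value \<open>k\<close> at \<open>w\<^sub>k\<close>. By local finiteness they are the coordinates of a
  continuous map of \<open>X\<close> into a Banach space, whose extension to \<open>F(X)\<close> is unbounded on \<open>K\<close>.\<close>

lemma finite_eval_word_nonzero_on_compact:
  fixes f :: "'i \<Rightarrow> 'a \<Rightarrow> real"
  assumes cont: "\<And>i. i \<in> I \<Longrightarrow> continuous_map X euclideanreal (f i)"
    and loc: "\<And>x. x \<in> topspace X \<Longrightarrow>
               \<exists>V. openin X V \<and> x \<in> V \<and> finite {i \<in> I. \<exists>z\<in>V. f i z \<noteq> 0}"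
    and K: "compactin (free_topology X) K"
  shows "finite {i \<in> I. \<exists>w\<in>K. eval_word real_group (f i) w \<noteq> 0}" (is "finite ?B")
proof (rule ccontr)
  assume "infinite ?B"
  then obtain s :: "nat \<Rightarrow> 'i" where s: "inj s" "range s \<subseteq> ?B"
    using infinite_countable_subset by blast
  then have "\<forall>k. \<exists>w\<in>K. eval_word real_group (f (s k)) w \<noteq> 0" by blast
  then obtain w where w: "\<And>k. w k \<in> K" "\<And>k. eval_word real_group (f (s k)) (w k) \<noteq> 0"
    by metis
  define c where "c k = real k / eval_word real_group (f (s k)) (w k)" for k
  define g where "g k x = (c k * f (s k) x) *\<^sub>R unit_bcontfun k" for k x
  define G where "G x = (\<Sum>k\<in>{k \<in> UNIV. g k x \<noteq> 0}. g k x)" for x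
  \<comment> \<open>Local finiteness survives the reindexing by \<open>s\<close> because
    \<open>s\<close> is injective.\<close>
  have fin: "finite {k. \<exists>z\<in>V. g k z \<noteq> 0}" if "finite {i \<in> I. \<exists>z\<in>V. f i z \<noteq> 0}" for V
  proof (rule finite_subset)
    show "{k. \<exists>z\<in>V. g k z \<noteq> 0} \<subseteq> s -` {i \<in> I. \<exists>z\<in>V. f i z \<noteq> 0}"
      using s(2) by (auto simp: g_def)
    show "finite (s -` {i \<in> I. \<exists>z\<in>V. f i z \<noteq> 0})"
      using that s(1) by (rule finite_vimageI)
  qed
  have "continuous_map X euclidean G"
    unfolding G_def
  proof (rule continuous_map_locally_finite_sum)
    show "continuous_map X euclidean (g k)" for k
    proof -
      have "continuous_map X euclideanreal (f (s k))" using cont s(2) by blast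
      then have "continuous_map X euclideanreal (\<lambda>x. c k * f (s k) x)"
        by (rule continuous_map_real_mult_left)
      moreover have "continuous_map euclideanreal euclidean (\<lambda>t. t *\<^sub>R unit_bcontfun k)"
        by (simp add: continuous_on_scaleR)
      ultimately have "continuous_map X euclidean
          ((\<lambda>t. t *\<^sub>R unit_bcontfun k) \<circ> (\<lambda>x. c k * f (s k) x))"
        by (rule continuous_map_compose)
      then show ?thesis by (simp add: g_def[abs_def] o_def)
    qed
    show "\<exists>V. openin X V \<and> x \<in> V \<and> finite {k \<in> UNIV. \<exists>z\<in>V. g k z \<noteq> 0}" if "x \<in> topspace X" for x
      using loc[OF that] fin by auto
  qed
  then have "continuous_map (free_topology X) euclidean (eval_word additive_group G)"
    by (rule continuous_map_eval_word[OF topological_group_additive_group])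
  then have "compact (eval_word additive_group G ` K)"
    using image_compactin[OF K] compactin_euclidean_iff by blast
  then have "bounded (eval_word additive_group G ` K)"
    by (rule compact_imp_bounded)
  then obtain b where b: "\<And>v. v \<in> K \<Longrightarrow> norm (eval_word additive_group G v) \<le> b"
    unfolding bounded_iff by blast
  have coord: "apply_bcontfun (G x) k = c k * f (s k) x" if "x \<in> topspace X" for x k
  proof -
    have J: "finite {j. g j x \<noteq> 0}"
    proof -
      obtain V where "x \<in> V" "finite {i \<in> I. \<exists>z\<in>V. f i z \<noteq> 0}"
        using loc[OF \<open>x \<in> topspace X\<close>] by blast
      then show ?thesis using finite_subset[OF _ fin, of "{j. g j x \<noteq> 0}"] by blast
    qed
    have "apply_bcontfun (G x) k = (\<Sum>j\<in>{j. g j x \<noteq> 0}. if j = k then c j * f (s j) x else 0)"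
      unfolding G_def apply_bcontfun_sum
      by (rule sum.cong) (simp_all add: g_def apply_unit_bcontfun)
    also have "\<dots> = (if g k x \<noteq> 0 then c k * f (s k) x else 0)"
      by (subst sum.delta[OF J]) simp
    also have "\<dots> = c k * f (s k) x"
    proof -
      have "unit_bcontfun k \<noteq> 0"
        using apply_unit_bcontfun[of k k] by auto
      then show ?thesis by (simp add: g_def)
    qed
    finally show ?thesis .
  qed
  have "real k \<le> b" for k
  proof -
    have sub: "fst ` set (w k) \<subseteq> topspace X"
      using w(1)[of k] compactin_subset_topspace[OF K] by (auto simp: carrier_free_group)
    have "apply_bcontfun (eval_word additive_group G (w k)) k
        = eval_word additive_group (\<lambda>x. apply_bcontfun (G x) k) (w k)"
      by (rule eval_word_additive_group) simp
    \<comment> \<open>The formula \<open>coord\<close> holds only on \<open>X\<close>, which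
      suffices since all letters of \<open>w k\<close> come from \<open>X\<close>.\<close>
    also have "\<dots> = eval_word real_group (\<lambda>x. c k * f (s k) x) (w k)"
      unfolding real_group_eq_additive_group eval_word_def
      by (rule foldr_cong) (use sub coord in \<open>auto simp: eval_letter_def\<close>)
    also have "\<dots> = real k"
      unfolding eval_word_real_scale using w(2)[of k] by (simp add: c_def)
    finally have "real k \<le> norm (eval_word additive_group G (w k))"
      using norm_bounded[of "eval_word additive_group G (w k)" k] by simp
    then show ?thesis using b[OF w(1)[of k]] by simp
  qed
  then show False
    using reals_Archimedean2[of b] by (meson not_le)
qed

section \<open>Separated sets and uncountable sets\<close>

text \<open>A maximal \<open>e\<close>-separated subset of \<open>S\<close> comes within
  \<open>e\<close> of every point of \<open>S\<close>. The union of such sets for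
  \<open>e = 1 / (n + 1)\<close> is countable and dense.\<close>

lemma (in Metric_space) separable_space_if_separated_countable:
  assumes S: "S \<subseteq> M"
    and ctb: "\<And>A e. A \<subseteq> S \<Longrightarrow> 0 < e \<Longrightarrow> pairwise (\<lambda>x y. e \<le> d x y) A \<Longrightarrow> countable A"
  shows "separable_space (subtopology mtopology S)"
proof -
  have "\<exists>A. A \<subseteq> S \<and> pairwise (\<lambda>x y. e \<le> d x y) A \<and> (\<forall>x\<in>S. \<exists>a\<in>A. d x a < e)"
    if "0 < e" for e
  proof -
    let ?\<A> = "{A. A \<subseteq> S \<and> pairwise (\<lambda>x y. e \<le> d x y) A}"
    have "\<exists>A\<in>?\<A>. \<forall>B\<in>?\<A>. A \<subseteq> B \<longrightarrow> B = A"
    proof (rule subset_Zorn')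
      fix C assume C: "subset.chain ?\<A> C"
      then have "pairwise (\<lambda>x y. e \<le> d x y) (\<Union>C)"
        by (intro pairwise_chain_Union) (auto simp: subset_chain_def chain_subset_def)
      with C show "\<Union>C \<in> ?\<A>" by (auto simp: subset_chain_def)
    qed
    then obtain A where A: "A \<subseteq> S" "pairwise (\<lambda>x y. e \<le> d x y) A"
      and max: "\<And>B. B \<subseteq> S \<Longrightarrow> pairwise (\<lambda>x y. e \<le> d x y) B \<Longrightarrow> A \<subseteq> B \<Longrightarrow> B = A"
      by auto
    have "\<exists>a\<in>A. d x a < e" if x: "x \<in> S" for x
    proof (rule ccontr)
      assume far: "\<not> (\<exists>a\<in>A. d x a < e)"
      then have "pairwise (\<lambda>x y. e \<le> d x y) (insert x A)"
        using A(2) by (auto simp: pairwise_insert commute not_less)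
      then have "x \<in> A" using max[of "insert x A"] A(1) x by blast
      then show False using far x S \<open>0 < e\<close> by force
    qed
    then show ?thesis using A by blast
  qed
  then have "\<forall>n. \<exists>A. A \<subseteq> S \<and> pairwise (\<lambda>x y. inverse (real (Suc n)) \<le> d x y) A
      \<and> (\<forall>x\<in>S. \<exists>a\<in>A. d x a < inverse (real (Suc n)))"
    by simp
  then obtain A where A: "\<And>n. A n \<subseteq> S"
    "\<And>n. pairwise (\<lambda>x y. inverse (real (Suc n)) \<le> d x y) (A n)"
    "\<And>n x. x \<in> S \<Longrightarrow> \<exists>a\<in>A n. d x a < inverse (real (Suc n))"
    by metis
  let ?U = "\<Union>n. A n"
  have "countable ?U" using ctb[OF A(1) _ A(2)] by simp
  moreover have "?U \<subseteq> topspace (subtopology mtopology S)" using A(1) S by auto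
  moreover have "S \<subseteq> mtopology closure_of ?U"
  proof
    fix x assume x: "x \<in> S"
    have "\<exists>y\<in>?U. y \<in> mball x r" if "r > 0" for r
    proof -
      obtain n where n: "inverse (real (Suc n)) < r" using reals_Archimedean[OF \<open>r > 0\<close>] by blast
      obtain a where "a \<in> A n" "d x a < inverse (real (Suc n))" using A(3)[OF x] by blast
      then show ?thesis using n A(1) S x by (force intro!: bexI[of _ a])
    qed
    then show "x \<in> mtopology closure_of ?U"
      using x S by (auto simp: metric_closure_of)
  qed
  ultimately show ?thesis
    unfolding separable_space_def
    using A(1) S by (intro exI[of _ ?U]) (auto simp: closure_of_subtopology Int_absorb1 UN_subset_iff)
qed

lemma uncountable_inj_real_close:
  fixes r :: "'a \<Rightarrow> real"
  assumes "uncountable A" "inj_on r A" "e > 0"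
  obtains a b where "a \<in> A" "b \<in> A" "a \<noteq> b" "\<bar>r a - r b\<bar> < e"
proof -
  \<comment> \<open>Countably many half-open intervals of length \<open>e\<close> cover the line, so
    two points of \<open>A\<close> have their \<open>r\<close>-values in the same one.\<close>
  have "\<not> inj_on (\<lambda>a. \<lfloor>r a / e\<rfloor>) A"
    using assms(1) countableI' countable_image_inj_on by blast
  then obtain a b where ab: "a \<in> A" "b \<in> A" "a \<noteq> b" "\<lfloor>r a / e\<rfloor> = \<lfloor>r b / e\<rfloor>"
    by (auto simp: inj_on_def)
  then have "\<bar>r a / e - r b / e\<bar> < 1" by linarith
  then have "\<bar>r a - r b\<bar> < e"
    using assms(3) by (simp add: field_simps flip: diff_divide_distrib)
  with ab that show ?thesis by blast
qed

text \<open>Cardinals are comparable: either \<open>A\<close> itself injects into the reals, or it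
  contains a copy of them.\<close>

lemma uncountable_subset_inj_real:
  assumes "uncountable A"
  obtains B and r :: "'a \<Rightarrow> real" where "B \<subseteq> A" "uncountable B" "inj_on r B"
proof (cases "\<exists>r :: 'a \<Rightarrow> real. inj_on r A")
  case True
  then show ?thesis using that assms by blast
next
  case False
  then have "(card_of A, card_of (UNIV :: real set)) \<notin> ordLeq"
    unfolding card_of_ordLeq[symmetric] by blast
  then have "(card_of (UNIV :: real set), card_of A) \<in> ordLeq"
    using ordLeq_total[OF card_of_Well_order card_of_Well_order, of A "UNIV :: real set"] by simp
  then obtain g :: "real \<Rightarrow> 'a" where g: "inj g" "range g \<subseteq> A"
    unfolding card_of_ordLeq[symmetric] by blast
  have "uncountable (range g)"
    using countable_image_inj_on[OF _ g(1)] uncountable_UNIV_real by blast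
  moreover have "inj_on (inv_into UNIV g) (range g)" by (rule inj_on_inv_into) simp
  ultimately show ?thesis using that g(2) by blast
qed


section \<open>Neighbourhoods of the identity and lengths of products\<close>

lemma openin_free_topology_mult:
  assumes U: "openin (free_topology X) U" "[] \<in> U"
  obtains V where "openin (free_topology X) V" "[] \<in> V"
    "\<And>u v. u \<in> V \<Longrightarrow> v \<in> V \<Longrightarrow> foldr push u v \<in> U"
proof -
  let ?F = "free_topology X"
  have "continuous_map (prod_topology ?F ?F) ?F (\<lambda>(u, v). foldr push u v)"
    using topological_group_free[of X] by (simp add: topological_group_def mult_free_group)
  then have "openin (prod_topology ?F ?F)
      {p \<in> topspace (prod_topology ?F ?F). (\<lambda>(u, v). foldr push u v) p \<in> U}"
    using U(1) openin_continuous_map_preimage by blast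
  moreover have "([], []) \<in> {p \<in> topspace (prod_topology ?F ?F). (\<lambda>(u, v). foldr push u v) p \<in> U}"
    using U(2) by (simp add: carrier_free_group)
  ultimately obtain V W where VW: "openin ?F V" "openin ?F W" "[] \<in> V" "[] \<in> W"
    "V \<times> W \<subseteq> {p \<in> topspace (prod_topology ?F ?F). (\<lambda>(u, v). foldr push u v) p \<in> U}"
    unfolding openin_prod_topology_alt by meson
  have "foldr push u v \<in> U" if "u \<in> V \<inter> W" "v \<in> V \<inter> W" for u v
    using VW(5) that by auto
  then show ?thesis
    using that[of "V \<inter> W"] VW by blast
qed

text \<open>The map taking \<open>x\<close> to the product of the inverse of \<open>a\<close> with
  \<open>x\<close> is continuous and sends \<open>a\<close> to the identity. Writing the product
  with \<open>push\<close> covers the cancellation at \<open>x = a\<close>.\<close>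

lemma openin_free_topology_translate:
  assumes V: "openin (free_topology X) V" "[] \<in> V" and a: "a \<in> topspace X"
  obtains W where "openin X W" "a \<in> W" "\<And>x. x \<in> W \<Longrightarrow> push (a, False) [(x, True)] \<in> V"
proof -
  let ?F = "free_topology X"
  have a': "[(a, False)] \<in> topspace ?F"
    using a by (simp add: carrier_free_group)
  have "continuous_map X (prod_topology ?F ?F) (\<lambda>x. ([(a, False)], free_basis x))"
    using a' continuous_map_free_basis by (simp add: continuous_map_paired)
  moreover have "continuous_map (prod_topology ?F ?F) ?F (\<lambda>(u, v). foldr push u v)"
    using topological_group_free[of X] by (simp add: topological_group_def mult_free_group)
  ultimately have "continuous_map X ?F
      ((\<lambda>(u, v). foldr push u v) \<circ> (\<lambda>x. ([(a, False)], free_basis x)))"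
    by (rule continuous_map_compose)
  then have "continuous_map X ?F (\<lambda>x. push (a, False) [(x, True)])"
    by (simp add: o_def free_basis_def del: push.simps)
  then have "openin X {x \<in> topspace X. push (a, False) [(x, True)] \<in> V}"
    using V(1) openin_continuous_map_preimage by blast
  moreover have "push (a, False) [(a, True)] \<in> V"
    using V(2) by (simp add: opp_def)
  ultimately show ?thesis
    using that[of "{x \<in> topspace X. push (a, False) [(x, True)] \<in> V}"] a by blast
qed

lemma length_push: "length (push s w) \<le> Suc (length w)"
  by (cases w) auto

lemma length_foldr_push: "length (foldr push u v) \<le> length u + length v"
proof (induction u)
  case (Cons s u)
  then show ?case using length_push[of s "foldr push u v"] by simp
qed simp

section \<open>Bump functions and the discontinuous sum\<close>

context Metric_space
begin

text \<open>A tent of height 1 centred at \<open>y\<close>, whose radius \<open>d a y\<close> is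
  just small enough that it vanishes at \<open>a\<close>.\<close>

definition bump :: "'a \<Rightarrow> 'a \<Rightarrow> 'a \<Rightarrow> real"
  where "bump a y x = max 0 (1 - d x y / d a y)"

lemma continuous_map_bump:
  assumes "a \<in> M" "y \<in> M" "a \<noteq> y"
  shows "continuous_map mtopology euclideanreal (bump a y)"
proof -
  have "continuous_map mtopology euclideanreal (\<lambda>x. d x y)"
    using continuous_map_mdist[of mtopology "metric (M, d)" "\<lambda>x. x" "\<lambda>_. y"] assms(2)
    by (simp add: mtopology_of mdist_metric)
  then show ?thesis
    unfolding bump_def[abs_def] using assms
    by (intro continuous_map_real_max continuous_map_diff continuous_map_real_divide) auto
qed

lemma bump_centre [simp]: "y \<in> M \<Longrightarrow> bump a y y = 1"
  by (simp add: bump_def)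

lemma bump_base [simp]: "a \<in> M \<Longrightarrow> y \<in> M \<Longrightarrow> a \<noteq> y \<Longrightarrow> bump a y a = 0"
  by (simp add: bump_def)

lemma bump_nonzero_imp:
  assumes "a \<in> M" "y \<in> M" "x \<in> M" "a \<noteq> y" "bump a y x \<noteq> 0"
  shows "d a x < 2 * d a y"
proof -
  have "d a y > 0" using assms by simp
  moreover from this have "d x y < d a y"
    using assms(5) by (auto simp: bump_def max_def field_simps split: if_splits)
  ultimately show ?thesis
    using triangle[of a y x] assms commute[of x y] by simp
qed

lemma not_k\<^sub>R_space_words_le:
  fixes r :: "'a \<Rightarrow> real"
  assumes A: "A \<subseteq> non_isolated mtopology" "uncountable A"
    and e: "0 < e" and sep: "pairwise (\<lambda>x y. e \<le> d x y) A" and r: "inj_on r A"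
  shows "\<not> k\<^sub>R_space (words_le 4 mtopology)"
proof
  assume kR: "k\<^sub>R_space (words_le 4 mtopology)"
  let ?F = "free_topology mtopology"
  have AM: "a \<in> M" if "a \<in> A" for a
    using A that by (auto simp: non_isolated_def)
  \<comment> \<open>The bound \<open>1 / (n + 1)\<close> gives convergence to \<open>a\<close>; the
    bound \<open>e / 8\<close> confines the bumps to the ball of radius \<open>e / 4\<close> around
    \<open>a\<close>.\<close>
  have "\<exists>y\<in>M. y \<noteq> a \<and> d a y < min (e / 8) (1 / real (Suc n))" if a: "a \<in> A" for a n
  proof (rule ccontr)
    assume "\<not> ?thesis"
    then have "mball a (min (e / 8) (1 / real (Suc n))) = {a}"
      using AM[OF a] e by auto
    then have "openin mtopology {a}" by (metis openin_mball)
    then show False using A a by (auto simp: non_isolated_def)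
  qed
  then obtain y where y: "\<And>a n. a \<in> A \<Longrightarrow> y a n \<in> M"
    "\<And>a n. a \<in> A \<Longrightarrow> a \<noteq> y a n" "\<And>a n. a \<in> A \<Longrightarrow> d a (y a n) < e / 8"
    "\<And>a n. a \<in> A \<Longrightarrow> d a (y a n) < 1 / real (Suc n)"
    by (metis min_less_iff_conj)
  \<comment> \<open>One index per pair, large when the \<open>r\<close>-values are close. On the
    diagonal \<open>1 / 0 = 0\<close> gives \<open>h a a = 0\<close>, which is harmless.\<close>
  define h where "h a b = nat \<lceil>1 / \<bar>r a - r b\<bar>\<rceil>" for a b
  define N where "N a n = eval_word real_group (bump a (y a n))" for a n
  \<comment> \<open>The product vanishes unless both factors are nonzero, and the squares make every
    term of \<open>S\<close> nonnegative.\<close>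
  define f where "f p w = (N (fst p) (h (fst p) (snd p)) w)\<^sup>2 * (N (snd p) (h (fst p) (snd p)) w)\<^sup>2"
    for p w
  define S where "S w = (\<Sum>p\<in>{p \<in> A \<times> A. f p w \<noteq> 0}. f p w)" for w
  have contN: "continuous_map ?F euclideanreal (N a n)" if "a \<in> A" for a n
    unfolding N_def using AM y that by (intro continuous_map_eval_word_real continuous_map_bump) auto
  have contf: "continuous_map ?F euclideanreal (f p)" if "p \<in> A \<times> A" for p
    unfolding f_def using that by (intro continuous_map_real_mult continuous_map_real_pow contN) auto
  have supp: "d a x < e / 4" if "a \<in> A" "x \<in> M" "bump a (y a n) x \<noteq> 0" for a n x
    using bump_nonzero_imp[of a "y a n" x] y(1)[of a n] y(2)[of a n] y(3)[of a n] AM that by force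
  have unique: "a = b" if "a \<in> A" "b \<in> A" "d a b < e" for a b
    using sep that by (auto simp: pairwise_def not_less[symmetric])
  have finN: "finite {a \<in> A. \<exists>n. \<exists>w\<in>K. N a n w \<noteq> 0}" if K: "compactin ?F K" for K
  proof -
    \<comment> \<open>The index may vary with the pair, so one witness is chosen for each
      \<open>a\<close>; this leaves a family indexed by \<open>A\<close> alone, to which the
      compactness lemma applies.\<close>
    define n where "n a = (SOME n. \<exists>w\<in>K. N a n w \<noteq> 0)" for a
    have "finite {a \<in> A. \<exists>w\<in>K. eval_word real_group (bump a (y a (n a))) w \<noteq> 0}"
    proof (rule finite_eval_word_nonzero_on_compact[OF _ _ K])
      show "continuous_map mtopology euclideanreal (bump a (y a (n a)))" if "a \<in> A" for a
        using AM y that by (intro continuous_map_bump) auto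
      show "\<exists>V. openin mtopology V \<and> x \<in> V \<and> finite {a \<in> A. \<exists>z\<in>V. bump a (y a (n a)) z \<noteq> 0}"
        if "x \<in> topspace mtopology" for x
      proof -
        have x: "x \<in> M" using that by simp
        let ?B = "{a \<in> A. \<exists>z\<in>mball x (e / 4). bump a (y a (n a)) z \<noteq> 0}"
        have near: "d a x < e / 2" if "a \<in> ?B" for a
        proof -
          obtain z where z: "z \<in> M" "d x z < e / 4" "bump a (y a (n a)) z \<noteq> 0"
            using \<open>a \<in> ?B\<close> by auto
          then have "d a z < e / 4" using supp that by auto
          then show ?thesis
            using triangle[of a z x] z AM[of a] that x commute[of x z] by auto
        qed
        \<comment> \<open>Two centres within \<open>e / 2\<close> of \<open>x\<close> are less than
          \<open>e\<close> apart, so \<open>?B\<close> has at most one element.\<close>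
        have "a = b" if "a \<in> ?B" "b \<in> ?B" for a b
          using near[OF that(1)] near[OF that(2)] triangle[of a x b] commute[of b x] x that AM
          by (intro unique) auto
        then have "finite ?B"
          by (metis (no_types, lifting) finite.emptyI finite_insert finite_subset insertI1 subsetI)
        then show ?thesis
          using x e by (intro exI[of _ "mball x (e / 4)"]) auto
      qed
    qed
    moreover have "\<exists>w\<in>K. N a (n a) w \<noteq> 0" if "\<exists>n. \<exists>w\<in>K. N a n w \<noteq> 0" for a
      unfolding n_def by (rule someI_ex) (rule that)
    ultimately show ?thesis
      by (elim finite_subset[rotated]) (auto simp: N_def)
  qed
  have finf: "finite {p \<in> A \<times> A. \<exists>w\<in>K. f p w \<noteq> 0}" if K: "compactin ?F K" for K
  proof (rule finite_subset)
    let ?A = "{a \<in> A. \<exists>n. \<exists>w\<in>K. N a n w \<noteq> 0}"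
    show "{p \<in> A \<times> A. \<exists>w\<in>K. f p w \<noteq> 0} \<subseteq> ?A \<times> ?A"
      by (fastforce simp: f_def)
    show "finite (?A \<times> ?A)" using finN[OF K] by simp
  qed
  have "continuous_map (words_le 4 mtopology) euclideanreal S"
  proof -
    have "continuous_map (subtopology (words_le 4 mtopology) K) euclideanreal S"
      if K: "compactin (words_le 4 mtopology) K" for K
    proof -
      have K': "compactin ?F K"
        using K by (simp add: words_le_def compactin_subtopology)
      have "continuous_map (subtopology ?F K) euclideanreal S"
        unfolding S_def
      proof (rule continuous_map_locally_finite_sum)
        show "continuous_map (subtopology ?F K) euclideanreal (f p)" if "p \<in> A \<times> A" for p
          using contf[OF that] by (rule continuous_map_from_subtopology)
        \<comment> \<open>The whole space \<open>K\<close> serves as the neighbourhood, since only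
          finitely many terms are nonzero on it.\<close>
        show "\<exists>V. openin (subtopology ?F K) V \<and> w \<in> V \<and> finite {p \<in> A \<times> A. \<exists>z\<in>V. f p z \<noteq> 0}"
          if "w \<in> topspace (subtopology ?F K)" for w
          using that finf[OF K'] compactin_subset_topspace[OF K']
          by (intro exI[of _ K]) (auto simp: openin_subtopology_refl)
      qed
      then show ?thesis
        using K compactin_subset_topspace[OF K]
        by (simp add: words_le_def subtopology_subtopology Int_absorb1)
    qed
    then show ?thesis using kR unfolding k\<^sub>R_space_def by blast
  qed
  then have "openin (words_le 4 mtopology) {w \<in> topspace (words_le 4 mtopology). S w \<in> {..<1}}"
    by (rule openin_continuous_map_preimage) auto
  then obtain U where U: "openin ?F U"
    "{w \<in> topspace (words_le 4 mtopology). S w \<in> {..<1}} =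
     U \<inter> {w \<in> carrier (free_group M). length w \<le> 4}"
    unfolding words_le_def openin_subtopology by auto
  have "S [] = 0"
    by (simp add: S_def f_def N_def eval_word_def real_group_def)
  then have "[] \<in> {w \<in> topspace (words_le 4 mtopology). S w \<in> {..<1}}"
    by (simp add: words_le_def carrier_free_group)
  then have "[] \<in> U" using U(2) by blast
  then obtain V where V: "openin ?F V" "[] \<in> V" "\<And>u v. u \<in> V \<Longrightarrow> v \<in> V \<Longrightarrow> foldr push u v \<in> U"
    using openin_free_topology_mult[OF U(1)] by blast
  have "\<exists>k. \<forall>n\<ge>k. push (a, False) [(y a n, True)] \<in> V" if a: "a \<in> A" for a
  proof -
    obtain W where W: "openin mtopology W" "a \<in> W"
      "\<And>x. x \<in> W \<Longrightarrow> push (a, False) [(x, True)] \<in> V"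
      using openin_free_topology_translate[OF V(1,2), of a] AM[OF a] by auto
    then obtain t where t: "t > 0" "mball a t \<subseteq> W"
      unfolding openin_mtopology by blast
    obtain k where k: "inverse (real (Suc k)) < t"
      using reals_Archimedean[OF t(1)] by blast
    have "y a n \<in> W" if "k \<le> n" for n
    proof -
      have "1 / real (Suc n) \<le> inverse (real (Suc k))"
        using that by (simp add: field_simps)
      then have "d a (y a n) < t" using y(4)[OF a, of n] k by linarith
      then show ?thesis using t(2) AM[OF a] y(1)[OF a] by auto
    qed
    then show ?thesis using W(3) by blast
  qed
  then obtain k where k: "\<And>a n. a \<in> A \<Longrightarrow> k a \<le> n \<Longrightarrow> push (a, False) [(y a n, True)] \<in> V"
    by metis
  \<comment> \<open>The threshold \<open>k a\<close> depends on \<open>a\<close>, but it takes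
    countably many values and is therefore constant on an uncountable subset of
    \<open>A\<close>.\<close>
  have "\<exists>m. uncountable {a \<in> A. k a = m}"
  proof (rule ccontr)
    assume "\<not> ?thesis"
    then have "countable (\<Union>m. {a \<in> A. k a = m})" by blast
    moreover have "(\<Union>m. {a \<in> A. k a = m}) = A" by auto
    ultimately show False using A(2) by simp
  qed
  then obtain m where m: "uncountable {a \<in> A. k a = m}" by blast
  \<comment> \<open>Closeness below \<open>1 / (m + 1)\<close> forces \<open>h a b\<close> to be at
    least \<open>m\<close>, the common threshold of \<open>a\<close> and \<open>b\<close>.\<close>
  obtain a b where "a \<in> {a \<in> A. k a = m}" "b \<in> {a \<in> A. k a = m}" "a \<noteq> b"
    and close: "\<bar>r a - r b\<bar> < 1 / real (Suc m)"
    by (rule uncountable_inj_real_close[OF m, of r "1 / real (Suc m)"])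
      (use r in \<open>auto intro: inj_on_subset\<close>)
  then have ab: "a \<in> A" "b \<in> A" "k a = m" "k b = m" "a \<noteq> b" by auto
  let ?n = "h a b"
  have "real m \<le> 1 / \<bar>r a - r b\<bar>"
  proof -
    have "\<bar>r a - r b\<bar> > 0" using ab r by (auto simp: inj_on_def)
    then show ?thesis using close by (simp add: field_simps)
  qed
  then have "m \<le> ?n" unfolding h_def by linarith
  \<comment> \<open>Both factors lie in \<open>V\<close>, so the product lies in \<open>U\<close>;
    it has length at most 4, so \<open>S g < 1\<close>.\<close>
  define g where "g = foldr push (push (a, False) [(y a ?n, True)]) (push (b, False) [(y b ?n, True)])"
  have "g \<in> U"
    unfolding g_def by (intro V(3) k) (use ab \<open>m \<le> ?n\<close> in auto)
  moreover have "g \<in> carrier (free_group M)"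
    using U(1) \<open>g \<in> U\<close> openin_subset by force
  moreover have "length g \<le> 4"
    using length_foldr_push[of "push (a, False) [(y a ?n, True)]" "push (b, False) [(y b ?n, True)]"]
      length_push[of "(a, False)" "[(y a ?n, True)]"] length_push[of "(b, False)" "[(y b ?n, True)]"]
    by (simp add: g_def)
  ultimately have "S g < 1" using U(2) by blast
  have Ng: "N c ?n g = bump c (y c ?n) (y a ?n) - bump c (y c ?n) a
      + (bump c (y c ?n) (y b ?n) - bump c (y c ?n) b)" for c
  proof -
    have "N c n (push (x, False) [(z, True)]) = bump c (y c n) z - bump c (y c n) x" for n x z
      by (auto simp: N_def eval_word_def eval_letter_def opp_def real_group_eq_additive_group)
    then show ?thesis
      unfolding g_def N_def eval_word_real_foldr by simp
  qed
  \<comment> \<open>A nonzero value would put \<open>z\<close> within \<open>e / 4\<close> of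
    \<open>c\<close> and within \<open>e / 8\<close> of \<open>c'\<close>, contradicting
    separation.\<close>
  have zero: "bump c (y c ?n) z = 0"
    if "c \<in> A" "c' \<in> A" "c \<noteq> c'" "z \<in> M" "d c' z < e / 8" for c c' z
  proof (rule ccontr)
    assume "bump c (y c ?n) z \<noteq> 0"
    then have "d c z < e / 4" using supp that by blast
    then have "d c c' < e"
      using triangle[of c z c'] commute[of z c'] that AM e by force
    then show False using unique that by blast
  qed
  \<comment> \<open>Of the four terms in \<open>Ng\<close>, only the bump at its own centre is
    nonzero.\<close>
  have "N a ?n g = 1" "N b ?n g = 1"
    unfolding Ng using ab y AM e zero[of a b b] zero[of a b "y b ?n"] zero[of b a a] zero[of b a "y a ?n"]
    by auto
  then have fg: "f (a, b) g = 1" by (simp add: f_def)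
  have "compactin ?F {g}"
    using \<open>g \<in> carrier (free_group M)\<close> by simp
  from finf[OF this] have "finite {p \<in> A \<times> A. f p g \<noteq> 0}" by simp
  moreover have "(a, b) \<in> {p \<in> A \<times> A. f p g \<noteq> 0}" using ab fg by simp
  moreover have "0 \<le> f p g" for p by (simp add: f_def)
  \<comment> \<open>A single term bounds a finite sum of nonnegative terms from below, so
    \<open>S g\<close> is at least 1.\<close>
  ultimately have "f (a, b) g \<le> S g"
    unfolding S_def by (intro member_le_sum) auto
  then show False using fg \<open>S g < 1\<close> by simp
qed

end

theorem theorem3p13:
  fixes X :: "'a topology"
  assumes "metrizable_space X"
    and "topspace X \<noteq> {}"
    and "k\<^sub>R_space (words_le 4 X)"
  shows "separable_space (subtopology X (non_isolated X))"
proof -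
  obtain M d where "Metric_space M d" and X: "X = Metric_space.mtopology M d"
    using assms(1) by (auto simp: metrizable_space_def)
  then interpret Metric_space M d by simp
  show ?thesis
    unfolding X
  proof (rule separable_space_if_separated_countable)
    show "non_isolated mtopology \<subseteq> M" by (auto simp: non_isolated_def)
    fix A and e :: real
    assume A: "A \<subseteq> non_isolated mtopology" and e: "0 < e"
      and sep: "pairwise (\<lambda>x y. e \<le> d x y) A"
    show "countable A"
    proof (rule ccontr)
      assume "uncountable A"
      then obtain B and r :: "'a \<Rightarrow> real" where B: "B \<subseteq> A" "uncountable B" "inj_on r B"
        by (rule uncountable_subset_inj_real)
      have "\<not> k\<^sub>R_space (words_le 4 mtopology)"
        by (rule not_k\<^sub>R_space_words_le[OF _ B(2) e pairwise_subset[OF sep B(1)] B(3)])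
          (use A B(1) in blast)
      then show False using assms(3) X by simp
    qed
  qed
qed

end
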